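(* Let $m\ge 1$ be a fixed number of bins, let $v^*$ be the optimum stretching factor of online bin stretching with $m$ bins, and for each integer $g\ge 1$ let $u_g$ be the min-max value of the upper bound game with granularity $g$ and $m$ bins. For every integer $g\ge1$, setting $$g'=g\left(1+\frac{m}{\sqrt g}+\frac1g\right)+\sqrt{g\left(1+\frac{m}{\sqrt g}+\frac1g\right)},$$ one has $$v^*\;\ge\;\left(u_g-\frac{m\sqrt g+2}{g}\right)\frac{g}{g'}.$$
   Context: **Online bin stretching.** Fix an integer $m\ge 1$ (number of bins). An input is a finite sequence of items, each with a positive real size, such that the whole set of items can be partitioned into $m$ groups each of total size at most $1$ (i.e. it fits into $m$ bins of unit size). Let $\mathcal I$ be the set of all such inputs. A (deterministic) online algorithm $A$ is a sequence of functions $(A_1,A_2,\dots)$, where $A_i$ takes the first $i$ item sizes and outputs the index in $\{1,\dots,m\}$ of the bin into which the $i$-th item is irrevocably placed. There is no capacity limit on the bins used by the algorithm. Let $\mathcal A$ be the set of online algorithms. For $I\in\mathcal I$, $A(I)$ is the load (sum of item sizes) of the fullest bin after packing $I$ according to $A$. The stretching factor of $A$ is $r(A)=\sup_{I\in\mathcal I}A(I)$, and the optimum stretching factor is $v^*=\inf_{A\in\mathcal A}r(A)$. **Upper bound game with granularity $g\in\mathbb N^*$ and $m$ bins.** This is a two-player zero-sum perfect-information game between the adversary (maximizer) and the algorithm (minimizer). Each of the $m$ bins has a load class, a nonnegative integer, initially $0$. In each round: 1. the adversary sends an item of class $\bar y\in\mathbb N=\{0,1,2,\dots\}$; 2. the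 algorithm chooses a bin; 3. the adversary chooses whether an overflow occurs: the load class of the chosen bin increases by $\bar y$ if there is no overflow, and by $\bar y+1$ if there is an overflow. The adversary's moves must always respect the following constraints: - the item classes $\bar y_1,\dots,\bar y_k$ sent so far, viewed as integer sizes, fit into $m$ bins of size $g-1$; - the sum of the load classes of the $m$ bins is at most $mg-1$; - if the item sent has class $0$, an overflow must occur. The game ends when the adversary is unable to send any item. The score is (the highest load class of a bin, plus one), expressed in the unit in which the unit bin size equals $g$; thus the normalized score is (highest load class $+1$)$/g$. The number $u_g$ is the min-max value of this game for the normalized score. (Interpretation: class $\bar y$ represents sizes or loads in the interval $]\bar y/g,(\bar y+1)/g]$.) *)

theory Defs
  imports Complex_Main
begin

text \<open>Bins are numbered \<open>0, \<dots>, m - 1\<close>.  A packing of a list of item sizes is a function from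
  item positions to bins.\<close>

definition bin_load :: "'a::ordered_comm_monoid_add list \<Rightarrow> (nat \<Rightarrow> nat) \<Rightarrow> nat \<Rightarrow> 'a" where
  "bin_load xs p j = (\<Sum>i | i < length xs \<and> p i = j. xs ! i)"

definition fits :: "nat \<Rightarrow> 'a::ordered_comm_monoid_add \<Rightarrow> 'a list \<Rightarrow> bool" where
  "fits m c xs \<longleftrightarrow>
     (\<exists>p. (\<forall>i<length xs. p i < m) \<and> (\<forall>j<m. bin_load xs p j \<le> c))"


section \<open>Online bin stretching\<close>

definition inputs :: "nat \<Rightarrow> real list set" where
  "inputs m = {xs. (\<forall>x\<in>set xs. 0 < x) \<and> fits m 1 xs}"

text \<open>The family \<open>(A\<^sub>1, A\<^sub>2, \<dots>)\<close> is one function on lists: \<open>A\<^sub>i\<close> is its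
  restriction to lists of length \<open>i\<close>.  The value at the empty list is never used.\<close>

definition online_algorithms :: "nat \<Rightarrow> (real list \<Rightarrow> nat) set" where
  "online_algorithms m = {A. \<forall>xs. A xs < m}"

definition online_packing :: "(real list \<Rightarrow> nat) \<Rightarrow> real list \<Rightarrow> nat \<Rightarrow> nat" where
  "online_packing A xs i = A (take (Suc i) xs)"

definition max_load :: "nat \<Rightarrow> (real list \<Rightarrow> nat) \<Rightarrow> real list \<Rightarrow> real" where
  "max_load m A xs = (MAX j\<in>{..<m}. bin_load xs (online_packing A xs) j)"

text \<open>For \<open>m \<ge> 1\<close> all these loads lie between \<open>0\<close> and \<open>m\<close>, so the real supremum and infimum
  below are the intended ones.\<close>

definition stretching_factor :: "nat \<Rightarrow> (real list \<Rightarrow> nat) \<Rightarrow> real" where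
  "stretching_factor m A = (SUP xs\<in>inputs m. max_load m A xs)"

definition opt_stretching :: "nat \<Rightarrow> real" where
  "opt_stretching m = (INF A\<in>online_algorithms m. stretching_factor m A)"


section \<open>The upper bound game\<close>

text \<open>A position consists of the list \<open>ys\<close> of item classes sent so far and the load classes
  \<open>L j\<close> of the bins \<open>j < m\<close>.  The adversary may send \<open>y\<close> only if some overflow decision is
  then legal; which decisions are legal does not depend on the bin chosen in between.\<close>

definition overflow_choices :: "nat \<Rightarrow> nat \<Rightarrow> (nat \<Rightarrow> nat) \<Rightarrow> nat \<Rightarrow> bool set" where
  "overflow_choices m g L y =
     {b. (y = 0 \<longrightarrow> b) \<and> (\<Sum>j<m. L j) + (y + of_bool b) \<le> m * g - 1}"

definition sendable :: "nat \<Rightarrow> nat \<Rightarrow> nat list \<Rightarrow> (nat \<Rightarrow> nat) \<Rightarrow> nat set" where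
  "sendable m g ys L = {y. fits m (g - 1) (ys @ [y]) \<and> overflow_choices m g L y \<noteq> {}}"

text \<open>The min-max value of a position.  The game is finite since the total load class grows in
  every round, and every \<open>MAX\<close> and \<open>MIN\<close> is over a finite nonempty set if \<open>m \<ge> 1\<close>.\<close>

function game_value :: "nat \<Rightarrow> nat \<Rightarrow> nat list \<Rightarrow> (nat \<Rightarrow> nat) \<Rightarrow> real" where
  "game_value m g ys L =
     (if sendable m g ys L = {} then (real (MAX j\<in>{..<m}. L j) + 1) / real g
      else (MAX y\<in>sendable m g ys L. MIN i\<in>{..<m}. MAX b\<in>overflow_choices m g L y.
              game_value m g (ys @ [y]) (L(i := L i + (y + of_bool b)))))"
  by pat_completeness auto

lemma sum_load_update:
  fixes L :: "nat \<Rightarrow> nat"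
  assumes "i < m"
  shows "(\<Sum>j<m. (L(i := L i + k)) j) = (\<Sum>j<m. L j) + k"
proof -
  have "(\<Sum>j<m. (L(i := L i + k)) j) = (\<Sum>j<m. L j + (if j = i then k else 0))"
    by (rule sum.cong) auto
  also have "\<dots> = (\<Sum>j<m. L j) + k"
    using assms by (simp add: sum.distrib)
  finally show ?thesis .
qed

termination
proof (relation "measure (\<lambda>(m, g, ys, L). m * g - (\<Sum>j<m. L j))", goal_cases)
  case 1
  then show ?case by simp
next
  case (2 m g ys L y i b)
  then have i: "i < m" and b: "b \<in> overflow_choices m g L y" by auto
  from b have "0 < y + (of_bool b :: nat)"
    and "(\<Sum>j<m. L j) + (y + of_bool b) \<le> m * g - 1"
    by (auto simp: overflow_choices_def)
  then show ?case
    by (simp only: in_measure prod.case sum_load_update[OF i])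
qed

declare game_value.simps [simp del]

lemma finite_overflow_choices: "finite (overflow_choices m g L y)"
  by simp

lemma finite_sendable: "finite (sendable m g ys L)"
  by (rule finite_subset[of _ "{..m * g}"]) (auto simp: sendable_def overflow_choices_def)

definition upper_game_value :: "nat \<Rightarrow> nat \<Rightarrow> real" where
  "upper_game_value m g = game_value m g [] (\<lambda>_. 0)"

end

theory Submission
  imports Defs "HOL-Library.Multiset"
begin

text \<open>
  Every online algorithm \<open>A\<close> yields a strategy for the algorithm player of the game.  Put
  \<open>s = sqrt g\<close>.  An item of class \<open>y\<close> with \<open>y + 1 > s\<close> is presented to \<open>A\<close> as an item of size
  \<open>y + 1\<close> and put where \<open>A\<close> puts it.  A smaller item is put into any bin whose load in the
  packing of \<open>A\<close> exceeds its load class by at least \<open>y + 1\<close>; if there is no such bin, a packet of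
  size \<open>s\<close> is presented to \<open>A\<close>, and the item goes where \<open>A\<close> puts the packet.  Load classes
  then never exceed the loads of \<open>A\<close>.

  The items presented to \<open>A\<close> fit into \<open>m\<close> bins of size \<open>C = g + 3 s + 1\<close>: at most \<open>s + 1\<close> large
  items share a bin in a packing of the classes, so rounding up costs at most \<open>s + 1\<close> per bin, and
  the packets are added greedily.  When a packet is presented all slacks are below \<open>s\<close>, so the total
  volume exceeds the total load class, at most \<open>m g - 1\<close>, by at most \<open>m s + s\<close> plus the number of
  large items.  Hence \<open>g u \<le> C r + 1\<close> for the stretching factor \<open>r\<close> of \<open>A\<close>, and the
  theorem follows from \<open>r \<le> m\<close> and \<open>C \<le> g' + s\<close>.
\<close>

section \<open>Packings\<close>

lemma bin_load_snoc:
  fixes xs :: "'a::ordered_comm_monoid_add list"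
  assumes "\<And>i. i < length xs \<Longrightarrow> q i = p i"
  shows "bin_load (xs @ [x]) q j = bin_load xs p j + (if q (length xs) = j then x else 0)"
proof -
  have "{i. i < length (xs @ [x]) \<and> q i = j}
      = {i. i < length xs \<and> p i = j} \<union> (if q (length xs) = j then {length xs} else {})"
    using assms by (auto simp: less_Suc_eq)
  moreover have "(\<Sum>i | i < length xs \<and> p i = j. (xs @ [x]) ! i) = bin_load xs p j"
    unfolding bin_load_def by (rule sum.cong) (auto simp: nth_append)
  ultimately show ?thesis
    unfolding bin_load_def by (auto simp: add.commute)
qed

lemma sum_bin_load:
  fixes xs :: "'a::ordered_comm_monoid_add list"
  assumes "\<And>i. i < length xs \<Longrightarrow> p i < m"
  shows "(\<Sum>j<m. bin_load xs p j) = sum_list xs"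
proof -
  have "(\<Sum>j<m. \<Sum>i | i \<in> {..<length xs} \<and> p i = j. xs ! i) = (\<Sum>i<length xs. xs ! i)"
    by (rule sum.group) (use assms in auto)
  then show ?thesis
    by (simp add: bin_load_def sum_list_sum_nth lessThan_atLeast0)
qed

lemma bin_load_map_divide:
  "bin_load (map (\<lambda>x. x / c) xs) p j = bin_load xs p j / (c::real)"
  by (simp add: bin_load_def sum_divide_distrib)

text \<open>The last item \<open>x\<close> is taken out of some part \<open>f k\<close> that
  contains its value and is placed in bin \<open>k\<close>. Equal sizes are interchangeable, so any
  such part will do.\<close>

lemma packing_of_multiset_partition:
  fixes xs :: "'a::ordered_comm_monoid_add list"
  assumes "(\<Sum>j<m. f j) = mset xs"
  shows "\<exists>p. (\<forall>i<length xs. p i < m) \<and> (\<forall>j<m. bin_load xs p j = sum_mset (f j))"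
  using assms
proof (induction xs arbitrary: f rule: rev_induct)
  case Nil
  have "f j = {#}" if "j < m" for j
    using Nil sum.remove[of "{..<m}" j f] that by simp
  then show ?case by (auto simp: bin_load_def)
next
  case (snoc x xs)
  have "x \<in># (\<Sum>j<m. f j)" using snoc.prems by simp
  then obtain k where k: "k < m" "x \<in># f k" by (auto simp: set_mset_sum)
  define h where "h = f(k := f k - {#x#})"
  have fk: "f k = h k + {#x#}" using k by (simp add: h_def)
  have fj: "f j = h j" if "j \<noteq> k" for j using that by (simp add: h_def)
  have "(\<Sum>j<m. f j) = (\<Sum>j<m. h j + (if j = k then {#x#} else {#}))"
    by (rule sum.cong) (use fk fj in auto)
  also have "\<dots> = (\<Sum>j<m. h j) + {#x#}" using k by (simp add: sum.distrib)
  finally have "(\<Sum>j<m. h j) = mset xs" using snoc.prems by simp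
  from snoc.IH[OF this] obtain p where
    p: "\<And>i. i < length xs \<Longrightarrow> p i < m" "\<And>j. j < m \<Longrightarrow> bin_load xs p j = sum_mset (h j)"
    by auto
  let ?q = "p(length xs := k)"
  have "bin_load (xs @ [x]) ?q j = bin_load xs p j + (if k = j then x else 0)" for j
    using bin_load_snoc[of xs ?q p x j] by simp
  then have "\<forall>j<m. bin_load (xs @ [x]) ?q j = sum_mset (f j)"
    using p(2) fk fj by (auto simp: add.commute)
  moreover have "\<forall>i<length (xs @ [x]). ?q i < m" using p(1) k by (auto simp: less_Suc_eq)
  ultimately show ?case by blast
qed

lemma multiset_partition_of_packing:
  fixes xs :: "'a::ordered_comm_monoid_add list"
  assumes "\<And>i. i < length xs \<Longrightarrow> p i < m"
  shows "\<exists>f. (\<Sum>j<m. f j) = mset xs \<and> (\<forall>j<m. sum_mset (f j) = bin_load xs p j)"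
  using assms
proof (induction xs rule: rev_induct)
  case Nil
  then show ?case by (intro exI[of _ "\<lambda>_. {#}"]) (auto simp: bin_load_def)
next
  case (snoc x xs)
  then obtain f where f: "(\<Sum>j<m. f j) = mset xs" "\<And>j. j < m \<Longrightarrow> sum_mset (f j) = bin_load xs p j"
    by force
  let ?h = "\<lambda>j. f j + (if j = p (length xs) then {#x#} else {#})"
  have "p (length xs) < m" using snoc.prems by simp
  then have "(\<Sum>j<m. ?h j) = mset (xs @ [x])" using f(1) by (simp add: sum.distrib)
  moreover have "\<forall>j<m. sum_mset (?h j) = bin_load (xs @ [x]) p j"
    using f(2) by (auto simp: bin_load_snoc[where p = p and q = p] add.commute)
  ultimately show ?case by (intro exI[of _ ?h]) blast
qed

text \<open>The classes sent and the sizes presented to the algorithm are lists without a common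
  indexing; this form lets their packings be compared as multisets.\<close>

lemma fits_iff_multiset_partition:
  "fits m c xs \<longleftrightarrow> (\<exists>f. (\<Sum>j<m. f j) = mset xs \<and> (\<forall>j<m. sum_mset (f j) \<le> c))"
proof
  assume "fits m c xs"
  then obtain p where p: "\<And>i. i < length xs \<Longrightarrow> p i < m" "\<And>j. j < m \<Longrightarrow> bin_load xs p j \<le> c"
    by (auto simp: fits_def)
  obtain f where f: "(\<Sum>j<m. f j) = mset xs" "\<And>j. j < m \<Longrightarrow> sum_mset (f j) = bin_load xs p j"
    using multiset_partition_of_packing[of xs p m] p(1) by blast
  then show "\<exists>f. (\<Sum>j<m. f j) = mset xs \<and> (\<forall>j<m. sum_mset (f j) \<le> c)"
    using p(2) by (intro exI[of _ f]) simp
next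
  assume "\<exists>f. (\<Sum>j<m. f j) = mset xs \<and> (\<forall>j<m. sum_mset (f j) \<le> c)"
  then obtain f where f: "(\<Sum>j<m. f j) = mset xs" "\<And>j. j < m \<Longrightarrow> sum_mset (f j) \<le> c"
    by blast
  obtain p where "\<forall>i<length xs. p i < m" "\<forall>j<m. bin_load xs p j = sum_mset (f j)"
    using packing_of_multiset_partition[OF f(1)] by blast
  then show "fits m c xs" unfolding fits_def using f(2) by (intro exI[of _ p]) simp
qed

text \<open>If no bin had room for another \<open>s\<close>, the total would already exceed
  \<open>m * (C - s)\<close>. Only the volume present before the last packet counts, hence the extra
  \<open>s\<close> in the volume bound.\<close>

lemma greedy_packing:
  fixes C s :: real
  assumes "m \<ge> 1" and "(\<Sum>j<m. f j) = M" and "\<And>j. j < m \<Longrightarrow> sum_mset (f j) \<le> C"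
    and "s > 0" and "sum_mset M + real K * s \<le> real m * (C - s) + s"
  shows "\<exists>h. (\<Sum>j<m. h j) = M + replicate_mset K s \<and> (\<forall>j<m. sum_mset (h j) \<le> C)"
  using assms(5)
proof (induction K)
  case 0
  then show ?case using assms by (intro exI[of _ f]) simp
next
  case (Suc K)
  then obtain h where h: "(\<Sum>j<m. h j) = M + replicate_mset K s" "\<And>j. j < m \<Longrightarrow> sum_mset (h j) \<le> C"
    using \<open>s > 0\<close> by (auto simp: algebra_simps)
  have "\<exists>k<m. sum_mset (h k) \<le> C - s"
  proof (rule ccontr)
    assume "\<not> ?thesis"
    then have "(\<Sum>j<m. C - s) < (\<Sum>j<m. sum_mset (h j))"
      using \<open>m \<ge> 1\<close> by (intro sum_strict_mono) (auto simp: lessThan_empty_iff)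
    also have "\<dots> = sum_mset (\<Sum>j<m. h j)"
      by (induction m) auto
    finally show False using Suc.prems by (simp add: h(1) algebra_simps)
  qed
  then obtain k where k: "k < m" "sum_mset (h k) \<le> C - s" by blast
  let ?h = "\<lambda>j. h j + (if j = k then {#s#} else {#})"
  have "(\<Sum>j<m. ?h j) = M + replicate_mset (Suc K) s" using h(1) k by (simp add: sum.distrib)
  moreover have "\<forall>j<m. sum_mset (?h j) \<le> C" using h(2) k by auto
  ultimately show ?case by (intro exI[of _ ?h]) blast
qed


section \<open>Stretching factors\<close>

lemma online_packing_less: "A \<in> online_algorithms m \<Longrightarrow> online_packing A xs i < m"
  by (simp add: online_algorithms_def online_packing_def)

text \<open>No bin holds more than the total volume, which is at most \<open>m\<close> because the
  input fits. This makes the supremum over all inputs meaningful.\<close>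

lemma max_load_le:
  assumes "m \<ge> 1" and "A \<in> online_algorithms m" and "xs \<in> inputs m"
  shows "max_load m A xs \<le> real m"
proof -
  obtain p where p: "\<And>i. i < length xs \<Longrightarrow> p i < m" "\<And>j. j < m \<Longrightarrow> bin_load xs p j \<le> 1"
    using assms(3) by (auto simp: inputs_def fits_def)
  have "sum_list xs = (\<Sum>j<m. bin_load xs p j)" using sum_bin_load[of xs p m] p(1) by simp
  also have "\<dots> \<le> (\<Sum>j<m. 1)" by (rule sum_mono) (use p(2) in auto)
  finally have total: "sum_list xs \<le> real m" by simp
  have nonneg: "0 \<le> bin_load xs q j" for q j
    unfolding bin_load_def using assms(3) by (intro sum_nonneg) (auto simp: inputs_def intro: less_imp_le)
  have "bin_load xs (online_packing A xs) j \<le> real m" if "j < m" for j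
  proof -
    have "bin_load xs (online_packing A xs) j \<le> (\<Sum>j<m. bin_load xs (online_packing A xs) j)"
      by (rule member_le_sum) (use that nonneg in auto)
    also have "\<dots> = sum_list xs" by (rule sum_bin_load) (rule online_packing_less[OF assms(2)])
    finally show ?thesis using total by simp
  qed
  then show ?thesis unfolding max_load_def using assms(1) by (auto simp: lessThan_empty_iff)
qed

lemma bin_load_le_stretching_factor:
  assumes "m \<ge> 1" and "A \<in> online_algorithms m" and "xs \<in> inputs m" and "j < m"
  shows "bin_load xs (online_packing A xs) j \<le> stretching_factor m A"
proof -
  have "bin_load xs (online_packing A xs) j \<le> max_load m A xs"
    unfolding max_load_def using assms(4) by (intro Max_ge) auto
  also have "\<dots> \<le> stretching_factor m A"
    unfolding stretching_factor_def using assms max_load_le[OF assms(1,2)]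
    by (intro cSUP_upper) (auto intro!: bdd_aboveI2)
  finally show ?thesis .
qed

lemma stretching_factor_le:
  assumes "m \<ge> 1" and "A \<in> online_algorithms m"
  shows "stretching_factor m A \<le> real m"
proof -
  have "[] \<in> inputs m" by (auto simp: inputs_def fits_def bin_load_def intro!: exI[of _ "\<lambda>_. 0"])
  then show ?thesis
    unfolding stretching_factor_def using max_load_le[OF assms] by (intro cSUP_least) auto
qed


section \<open>Strategies for the algorithm player\<close>

text \<open>An invariant that the algorithm can preserve whatever class is sent and whether or not
  it overflows is a strategy. The induction is on the load class that may still be added.\<close>

lemma game_value_le:
  assumes "m \<ge> 1" and "Inv ys L"
    and step: "\<And>ys L y. Inv ys L \<Longrightarrow> y \<in> sendable m g ys L \<Longrightarrow>
      \<exists>i<m. \<forall>b\<in>overflow_choices m g L y. Inv (ys @ [y]) (L(i := L i + (y + of_bool b)))"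
    and final: "\<And>ys L j. Inv ys L \<Longrightarrow> j < m \<Longrightarrow> (real (L j) + 1) / real g \<le> c"
  shows "game_value m g ys L \<le> c"
  using assms(2)
proof (induction "m * g - (\<Sum>j<m. L j)" arbitrary: ys L rule: less_induct)
  case less
  have ne: "{..<m} \<noteq> {}" using assms(1) by (auto simp: lessThan_empty_iff)
  show ?case
  proof (cases "sendable m g ys L = {}")
    case True
    have "(MAX j\<in>{..<m}. L j) \<in> L ` {..<m}" using ne by (intro Max_in) auto
    then show ?thesis using final[OF less.prems] True by (auto simp: game_value.simps[of m g ys L])
  next
    case False
    have "(MIN i\<in>{..<m}. MAX b\<in>overflow_choices m g L y.
              game_value m g (ys @ [y]) (L(i := L i + (y + of_bool b)))) \<le> c"
      if y: "y \<in> sendable m g ys L" for y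
    proof -
      obtain i where i: "i < m"
        "\<And>b. b \<in> overflow_choices m g L y \<Longrightarrow> Inv (ys @ [y]) (L(i := L i + (y + of_bool b)))"
        using step[OF less.prems y] by blast
      have "game_value m g (ys @ [y]) (L(i := L i + (y + of_bool b))) \<le> c"
        if b: "b \<in> overflow_choices m g L y" for b
      proof (rule less.hyps[OF _ i(2)[OF b]])
        have "0 < y + (of_bool b :: nat)" "(\<Sum>j<m. L j) + (y + of_bool b) \<le> m * g - 1"
          using b by (auto simp: overflow_choices_def)
        then show "m * g - (\<Sum>j<m. (L(i := L i + (y + of_bool b))) j) < m * g - (\<Sum>j<m. L j)"
          by (simp only: sum_load_update[OF i(1)])
      qed
      moreover have "overflow_choices m g L y \<noteq> {}" using y by (simp add: sendable_def)
      ultimately have "(MAX b\<in>overflow_choices m g L y.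
              game_value m g (ys @ [y]) (L(i := L i + (y + of_bool b)))) \<le> c" by simp
      then show ?thesis using i(1) ne by (subst Min_le_iff) auto
    qed
    then show ?thesis
      using False by (subst game_value.simps) (simp add: finite_sendable)
  qed
qed


section \<open>Simulation of an online algorithm\<close>

definition large :: "nat \<Rightarrow> nat \<Rightarrow> bool" where
  "large g y \<longleftrightarrow> sqrt (real g) < real y + 1"

text \<open>The upper end \<open>y + 1\<close> of the class interval covers the growth of the load
  class with or without overflow.\<close>

definition large_sizes :: "nat \<Rightarrow> nat multiset \<Rightarrow> real multiset" where
  "large_sizes g Y = {#real y + 1. y \<in># filter_mset (large g) Y#}"

text \<open>Here \<open>B\<close> sees the sizes \<open>ws\<close> in the unit in which the unit bin size equals the capacity
  \<open>C\<close> needed to pack them.\<close>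

definition sim_invariant ::
    "nat \<Rightarrow> nat \<Rightarrow> (real list \<Rightarrow> nat) \<Rightarrow> nat list \<Rightarrow> (nat \<Rightarrow> nat) \<Rightarrow> real list \<Rightarrow> bool" where
  "sim_invariant m g B ys L ws \<longleftrightarrow>
     fits m (g - 1) ys \<and> (\<Sum>j<m. L j) \<le> m * g - 1 \<and>
     (\<exists>K. mset ws = large_sizes g (mset ys) + replicate_mset K (sqrt (real g))) \<and>
     (\<forall>j<m. real (L j) \<le> bin_load ws (online_packing B ws) j) \<and>
     sum_list ws \<le> real (\<Sum>j<m. L j) + real m * sqrt (real g) + sqrt (real g)
        + real (size (filter_mset (large g) (mset ys)))"

text \<open>An online decision depends only on a prefix, so appending an item moves no earlier
  one.\<close>

lemma bin_load_online_snoc: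
  "bin_load (ws @ [w]) (online_packing B (ws @ [w])) j
     = bin_load ws (online_packing B ws) j + (if B (ws @ [w]) = j then w else (0::real))"
  using bin_load_snoc[of ws "online_packing B (ws @ [w])" "online_packing B ws" w j]
  by (simp add: online_packing_def)

text \<open>Both the bin and \<open>ws'\<close> are fixed before \<open>b\<close> is known; this is
  possible because room for \<open>y + 1\<close> is always secured.\<close>

lemma sim_invariant_step:
  assumes B: "B \<in> online_algorithms m" and inv: "sim_invariant m g B ys L ws"
    and y: "y \<in> sendable m g ys L"
  shows "\<exists>i<m. \<exists>ws'. \<forall>b\<in>overflow_choices m g L y.
           sim_invariant m g B (ys @ [y]) (L(i := L i + (y + of_bool b))) ws'"
proof -
  let ?s = "sqrt (real g)"
  let ?load = "\<lambda>ws. bin_load ws (online_packing B ws)"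
  obtain K where K: "mset ws = large_sizes g (mset ys) + replicate_mset K ?s"
    using inv by (auto simp: sim_invariant_def)
  have load: "real (L j) \<le> ?load ws j" if "j < m" for j
    using inv that by (auto simp: sim_invariant_def)
  have vol: "sum_list ws \<le> real (\<Sum>j<m. L j) + real m * ?s + ?s
        + real (size (filter_mset (large g) (mset ys)))"
    using inv by (auto simp: sim_invariant_def)
  have fit: "fits m (g - 1) (ys @ [y])" using y by (simp add: sendable_def)
  have sum_L: "(\<Sum>j<m. (L(i := L i + (y + of_bool b))) j) = (\<Sum>j<m. L j) + (y + of_bool b)"
    if "i < m" for i b using sum_load_update[OF that] .
  have bound: "(\<Sum>j<m. L j) + (y + of_bool b) \<le> m * g - 1" if "b \<in> overflow_choices m g L y" for b
    using that by (simp add: overflow_choices_def)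
  have B_less: "B xs < m" for xs using B by (simp add: online_algorithms_def)
  have ob: "of_bool b \<le> (1::real)" for b by simp
  consider (large) "large g y"
    | (room) i where "\<not> large g y" "i < m" "real (L i) + (real y + 1) \<le> ?load ws i"
    | (packet) "\<not> large g y" "\<And>j. j < m \<Longrightarrow> ?load ws j < real (L j) + (real y + 1)"
    by force
  then show ?thesis
  proof cases
    case large
    let ?ws = "ws @ [real y + 1]"
    have "sim_invariant m g B (ys @ [y]) (L(B ?ws := L (B ?ws) + (y + of_bool b))) ?ws"
      if b: "b \<in> overflow_choices m g L y" for b
      unfolding sim_invariant_def sum_L[OF B_less]
    proof (intro conjI)
      show "\<exists>K. mset ?ws = large_sizes g (mset (ys @ [y])) + replicate_mset K ?s"
        using K large by (intro exI[of _ K]) (simp add: large_sizes_def)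
      show "\<forall>j<m. real ((L(B ?ws := L (B ?ws) + (y + of_bool b))) j) \<le> ?load ?ws j"
        using load[OF B_less[of ?ws]] load ob[of b] by (auto simp: bin_load_online_snoc)
    \<comment> \<open>The volume grows by \<open>y + 1\<close> and the total load class by at least
      \<open>y\<close>; the count of large items absorbs the difference.\<close>
    qed (use fit bound[OF b] vol large in auto)
    then show ?thesis using B_less by blast
  next
    case (room i)
    have "sim_invariant m g B (ys @ [y]) (L(i := L i + (y + of_bool b))) ws"
      if b: "b \<in> overflow_choices m g L y" for b
      unfolding sim_invariant_def sum_L[OF room(2)]
    proof (intro conjI)
      show "\<exists>K. mset ws = large_sizes g (mset (ys @ [y])) + replicate_mset K ?s"
        using K room(1) by (intro exI[of _ K]) (simp add: large_sizes_def)
      show "\<forall>j<m. real ((L(i := L i + (y + of_bool b))) j) \<le> ?load ws j"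
        using load room(3) ob[of b] by auto
    qed (use fit bound[OF b] vol room(1) in auto)
    then show ?thesis using room(2) by blast
  next
    case packet
    let ?ws = "ws @ [?s]"
    have small: "real y + 1 \<le> ?s" using packet(1) by (simp add: large_def)
    \<comment> \<open>The volume bound is rebuilt from the slacks, all below \<open>?s\<close> here,
      so the excess does not accumulate over packets. The new packet then adds one more
      \<open>?s\<close>.\<close>
    have "sum_list ws = (\<Sum>j<m. ?load ws j)"
      by (rule sum_bin_load[symmetric]) (rule online_packing_less[OF B])
    also have "\<dots> \<le> (\<Sum>j<m. real (L j) + ?s)"
      by (rule sum_mono) (use packet(2) small in force)
    finally have vol': "sum_list ws \<le> real (\<Sum>j<m. L j) + real m * ?s" by (simp add: sum.distrib)
    have "sim_invariant m g B (ys @ [y]) (L(B ?ws := L (B ?ws) + (y + of_bool b))) ?ws"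
      if b: "b \<in> overflow_choices m g L y" for b
      unfolding sim_invariant_def sum_L[OF B_less]
    proof (intro conjI)
      show "\<exists>K. mset ?ws = large_sizes g (mset (ys @ [y])) + replicate_mset K ?s"
        using K packet(1) by (intro exI[of _ "Suc K"]) (simp add: large_sizes_def)
      show "\<forall>j<m. real ((L(B ?ws := L (B ?ws) + (y + of_bool b))) j) \<le> ?load ?ws j"
      proof (intro allI impI)
        fix j assume "j < m"
        then show "real ((L(B ?ws := L (B ?ws) + (y + of_bool b))) j) \<le> ?load ?ws j"
          using load[of j] small ob[of b] by (auto simp: bin_load_online_snoc)
      qed
    qed (use fit bound[OF b] vol' packet(1) in auto)
    then show ?thesis using B_less by blast
  qed
qed

section \<open>Packing the presented items\<close>

text \<open>With \<open>s = sqrt g\<close>, each large class exceeds \<open>s - 1\<close>, while the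
  classes sum to at most \<open>g - 1 = (s + 1) * (s - 1)\<close>.\<close>

lemma size_large_le:
  assumes "g \<ge> 1" and "sum_mset Y \<le> g - 1"
  shows "real (size (filter_mset (large g) Y)) \<le> sqrt (real g) + 1"
proof -
  let ?s = "sqrt (real g)" and ?Z = "filter_mset (large g) Y"
  have s: "?s \<ge> 1" "?s * ?s = real g" using assms(1) by auto
  have "sum_mset ?Z \<le> sum_mset Y"
    by (metis le_add1 multiset_partition sum_mset.union)
  then have Z: "real (sum_mset ?Z) \<le> real g - 1" using assms by linarith
  show ?thesis
  proof (cases "g = 1")
    \<comment> \<open>Here \<open>s - 1 = 0\<close> cannot be cancelled, but every class is
      \<open>0\<close> and class \<open>0\<close> is not large.\<close>
    case True
    have "y = 0" if "y \<in># Y" for y using assms(2) True that by auto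
    then have "set_mset ?Z = {}" using True by (auto simp: large_def)
    then show ?thesis using s by (simp only: set_mset_eq_empty_iff size_empty of_nat_0)
  next
    case False
    then have s1: "?s > 1" using assms(1) by simp
    have "real (size M) * (?s - 1) \<le> real (sum_mset M)" if "\<forall>y\<in>#M. large g y" for M
      using that by (induction M) (auto simp: large_def algebra_simps)
    from this[of ?Z] have "real (size ?Z) * (?s - 1) \<le> (?s + 1) * (?s - 1)"
      using Z s(2) by (simp add: algebra_simps)
    then show ?thesis using s1 by (simp add: mult_le_cancel_right)
  qed
qed

lemma sum_large_sizes_le:
  assumes "g \<ge> 1" and "sum_mset Y \<le> g - 1"
  shows "sum_mset (large_sizes g Y) \<le> real g + sqrt (real g)"
proof -
  have "sum_mset (large_sizes g Y) \<le> real (sum_mset Y) + real (size (filter_mset (large g) Y))"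
    unfolding large_sizes_def by (induction Y) auto
  moreover have "real (sum_mset Y) \<le> real g - 1" using assms by linarith
  ultimately show ?thesis using size_large_le[OF assms] by linarith
qed

lemma sim_invariant_fits:
  assumes "m \<ge> 1" and "g \<ge> 1" and inv: "sim_invariant m g B ys L ws"
  shows "fits m (real g + 3 * sqrt (real g) + 1) ws"
proof -
  let ?s = "sqrt (real g)"
  \<comment> \<open>The volume is at most
    \<open>m * g + m * s + s + m * (s + 1) = m * (C - s) + s\<close>, where \<open>s\<close> is
    \<open>?s\<close>; this is the greedy condition and determines \<open>C\<close>.\<close>
  let ?C = "real g + 3 * ?s + 1"
  have s: "?s \<ge> 1" using assms by simp
  obtain K where K: "mset ws = large_sizes g (mset ys) + replicate_mset K ?s"
    using inv by (auto simp: sim_invariant_def)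
  obtain f where f: "(\<Sum>j<m. f j) = mset ys" "\<And>j. j < m \<Longrightarrow> sum_mset (f j) \<le> g - 1"
    using inv by (auto simp: sim_invariant_def fits_iff_multiset_partition)
  have "size (filter_mset (large g) (\<Sum>j<k. f j)) = (\<Sum>j<k. size (filter_mset (large g) (f j)))" for k
    by (induction k) auto
  then have "real (size (filter_mset (large g) (mset ys)))
      = (\<Sum>j<m. real (size (filter_mset (large g) (f j))))"
    using f(1) by (metis of_nat_sum)
  also have "\<dots> \<le> (\<Sum>j<m. ?s + 1)"
    by (rule sum_mono) (use size_large_le[OF assms(2) f(2)] in auto)
  finally have count: "real (size (filter_mset (large g) (mset ys))) \<le> real m * (?s + 1)" by simp
  have "real (\<Sum>j<m. L j) \<le> real (m * g - 1)"
    using inv unfolding sim_invariant_def of_nat_le_iff by blast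
  also have "\<dots> \<le> real m * real g" by (metis diff_le_self of_nat_le_iff of_nat_mult)
  finally have "sum_list ws \<le> real m * (?C - ?s) + ?s"
    using inv count by (simp add: sim_invariant_def algebra_simps)
  then have vol: "sum_mset (large_sizes g (mset ys)) + real K * ?s \<le> real m * (?C - ?s) + ?s"
    using arg_cong[OF K, of sum_mset] by (simp add: sum_mset_sum_list)
  have "(\<Sum>j<k. large_sizes g (f j)) = large_sizes g (\<Sum>j<k. f j)" for k
    by (induction k) (auto simp: large_sizes_def)
  then have "(\<Sum>j<m. large_sizes g (f j)) = large_sizes g (mset ys)" using f(1) by simp
  moreover have "sum_mset (large_sizes g (f j)) \<le> ?C" if "j < m" for j
    using sum_large_sizes_le[OF assms(2) f(2)[OF that]] s by linarith
  ultimately show ?thesis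
    unfolding fits_iff_multiset_partition K
    using greedy_packing[of m "\<lambda>j. large_sizes g (f j)" _ ?C ?s K] assms(1) s vol by auto
qed

section \<open>From the simulation to the game value\<close>

text \<open>Dividing by \<open>C\<close> turns the presented sizes into a legal input of
  \<open>A\<close>, whose loads are those of the simulation divided by \<open>C\<close>.\<close>

lemma sim_invariant_load_le:
  assumes "m \<ge> 1" and "g \<ge> 1" and A: "A \<in> online_algorithms m"
    and C: "C = real g + 3 * sqrt (real g) + 1"
    and inv: "sim_invariant m g (\<lambda>ws. A (map (\<lambda>w. w / C) ws)) ys L ws" and "j < m"
  shows "real (L j) \<le> C * stretching_factor m A"
proof -
  let ?B = "\<lambda>ws. A (map (\<lambda>w. w / C) ws)" and ?xs = "map (\<lambda>w. w / C) ws"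
  have "C > 0" using C by (simp add: add_nonneg_pos)
  obtain K where K: "mset ws = large_sizes g (mset ys) + replicate_mset K (sqrt (real g))"
    using inv by (auto simp: sim_invariant_def)
  have "\<forall>w\<in>#mset ws. w > 0"
    unfolding K using assms(2) by (auto simp: large_sizes_def)
  then have pos: "\<forall>x\<in>set ?xs. x > 0" using \<open>C > 0\<close> by auto
  have "fits m C ws" using sim_invariant_fits[OF assms(1,2) inv] C by simp
  then have "fits m 1 ?xs"
    using \<open>C > 0\<close> by (auto simp: fits_def bin_load_map_divide)
  with pos have input: "?xs \<in> inputs m" by (simp add: inputs_def)
  have "real (L j) \<le> bin_load ws (online_packing ?B ws) j"
    using inv \<open>j < m\<close> by (simp add: sim_invariant_def)
  also have "online_packing ?B ws = online_packing A ?xs"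
    by (auto simp: online_packing_def take_map)
  also have "bin_load ws (online_packing A ?xs) j = C * bin_load ?xs (online_packing A ?xs) j"
    using \<open>C > 0\<close> by (simp add: bin_load_map_divide)
  also have "\<dots> \<le> C * stretching_factor m A"
    using bin_load_le_stretching_factor[OF assms(1) A input \<open>j < m\<close>] \<open>C > 0\<close> by simp
  finally show ?thesis .
qed

lemma upper_game_value_le:
  assumes "m \<ge> 1" and "g \<ge> 1" and A: "A \<in> online_algorithms m"
  shows "upper_game_value m g
    \<le> ((real g + 3 * sqrt (real g) + 1) * stretching_factor m A + 1) / real g"
proof -
  define C where "C = real g + 3 * sqrt (real g) + 1"
  let ?B = "\<lambda>ws. A (map (\<lambda>w. w / C) ws)"
  have B: "?B \<in> online_algorithms m" using A by (simp add: online_algorithms_def)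
  have init: "sim_invariant m g ?B [] (\<lambda>_. 0) []"
    using assms(1) by (auto simp: sim_invariant_def fits_def bin_load_def large_sizes_def)
  show ?thesis
    unfolding upper_game_value_def C_def[symmetric]
  \<comment> \<open>A game position does not record the presented sizes, so they are existentially
    quantified.\<close>
  proof (rule game_value_le[where Inv = "\<lambda>ys L. \<exists>ws. sim_invariant m g ?B ys L ws"])
    fix ys L y assume "\<exists>ws. sim_invariant m g ?B ys L ws" "y \<in> sendable m g ys L"
    then show "\<exists>i<m. \<forall>b\<in>overflow_choices m g L y.
        \<exists>ws. sim_invariant m g ?B (ys @ [y]) (L(i := L i + (y + of_bool b))) ws"
      using sim_invariant_step[OF B] by blast
  next
    fix ys L j assume "\<exists>ws. sim_invariant m g ?B ys L ws" "j < m"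
    then show "(real (L j) + 1) / real g \<le> (C * stretching_factor m A + 1) / real g"
      using sim_invariant_load_le[OF assms C_def] by (auto intro!: divide_right_mono)
  qed (use assms(1) init in auto)
qed

theorem corollary2p3:
  fixes m g :: nat and g' :: real
  assumes "m \<ge> 1" and "g \<ge> 1"
    and "g' = real g * (1 + real m / sqrt (real g) + 1 / real g)
              + sqrt (real g * (1 + real m / sqrt (real g) + 1 / real g))"
  shows "opt_stretching m
           \<ge> (upper_game_value m g - (real m * sqrt (real g) + 2) / real g) * (real g / g')"
proof -
  let ?s = "sqrt (real g)"
  have s: "?s \<ge> 1" "?s * ?s = real g" and g: "real g > 0" using assms(2) by auto
  have "real g * (real m / ?s) = real m * ?s" using s by (simp add: field_simps)
  then have G: "real g * (1 + real m / ?s + 1 / real g) = real g + real m * ?s + 1"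
    using g by (simp add: algebra_simps)
  \<comment> \<open>With \<open>G = g + m * s + 1\<close>, \<open>g'\<close> is
    \<open>G + sqrt G\<close>, and \<open>sqrt G\<close> is at least \<open>s\<close>.\<close>
  have "?s \<le> sqrt (real g + real m * ?s + 1)" using s by (intro real_sqrt_le_mono) auto
  then have g': "g' \<ge> real g + real m * ?s + 1 + ?s" using assms(3) unfolding G by simp
  have "1 * ?s \<le> real m * ?s" by (rule mult_right_mono) (use assms(1) s in auto)
  then have C_le: "real g + 3 * ?s + 1 \<le> g' + ?s" and "g' > 0" using g' g s by linarith+
  show ?thesis unfolding opt_stretching_def
  proof (rule cINF_greatest)
    show "online_algorithms m \<noteq> {}"
      using assms(1) by (auto simp: online_algorithms_def intro!: exI[of _ "\<lambda>_. 0"])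
  next
    fix A assume A: "A \<in> online_algorithms m"
    let ?r = "stretching_factor m A"
    have "[] \<in> inputs m" by (auto simp: inputs_def fits_def bin_load_def intro!: exI[of _ "\<lambda>_. 0"])
    from bin_load_le_stretching_factor[OF assms(1) A this, of 0] assms(1)
    have "?r \<ge> 0" by (simp add: bin_load_def)
    \<comment> \<open>Replacing \<open>C\<close> by \<open>g'\<close> costs at most
      \<open>s * r\<close>, hence at most \<open>m * s\<close>; the subtracted
      \<open>m * s + 2\<close> pays for this and for the \<open>1\<close> in the score.\<close>
    then have "(real g + 3 * ?s + 1) * ?r \<le> (g' + ?s) * ?r"
      using C_le by (intro mult_right_mono)
    moreover have "?s * ?r \<le> ?s * real m"
      using stretching_factor_le[OF assms(1) A] s by (intro mult_left_mono) auto
    moreover have "upper_game_value m g * real g \<le> (real g + 3 * ?s + 1) * ?r + 1"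
      using upper_game_value_le[OF assms(1,2) A] g by (simp add: field_simps)
    ultimately have "upper_game_value m g * real g - (real m * ?s + 2) \<le> ?r * g'"
      by (simp add: algebra_simps)
    moreover have "(upper_game_value m g - (real m * ?s + 2) / real g) * (real g / g')
        = (upper_game_value m g * real g - (real m * ?s + 2)) / g'"
      using g by (simp add: left_diff_distrib diff_divide_distrib)
    ultimately show "(upper_game_value m g - (real m * ?s + 2) / real g) * (real g / g') \<le> ?r"
      using \<open>g' > 0\<close> by (simp add: pos_divide_le_eq)
  qed
qed

end
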